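(* Let $L_\bullet$ be an eg-Lie algebra. There is a graded Lie algebra structure on $\mathrm{Der}_+(L_\bullet)=(\mathrm{Der}_m(L_\bullet))_{m\ge1}$ such that, for $m,n\ge 1$, the Lie bracket $$[\cdot,\cdot]:\mathrm{Der}_m(L_\bullet)\times\mathrm{Der}_n(L_\bullet)\longrightarrow\mathrm{Der}_{m+n}(L_\bullet)$$ is given by $$[d,d']_i(a)=\begin{cases} d_n(d'_0(a))-d'_m(d_0(a))-[d_0(a),d'_0(a)] & (i=0,\ a\in L_0),\\ d_{n+i}(d'_i(a))-d'_{m+i}(d_i(a)) & (i\ge 1,\ a\in L_i).\end{cases}$$
   Context: Eg-Lie algebra (extended graded Lie algebra) $L_\bullet=(L_m)_{m\ge 0}$: a group $L_0$, a graded Lie algebra $L_+=(L_m)_{m\ge 1}$ over $\mathbb Z$ (abelian groups $L_m$ with bilinear brackets $L_m\times L_n\to L_{m+n}$ that are alternating, antisymmetric and satisfy the Jacobi identity), and an action $(g,x)\mapsto {}^gx$ of $L_0$ on $L_+$ by degree-preserving Lie algebra automorphisms. For $m\ge 1$, a derivation of $L_\bullet$ of degree $m$ is a family of maps $d=(d_i:L_i\to L_{m+i})_{i\ge0}$ such that (1) the $d_i$, $i\ge 1$, are group homomorphisms with $d_{i+j}([a,b])=[d_i(a),b]+[a,d_j(b)]$ for $a\in L_i$, $b\in L_j$, $i,j\ge1$; (2) $d_0:L_0\to L_m$ is a $1$-cocycle: $d_0(ab)=d_0(a)+{}^a(d_0(b))$ for $a,b\in L_0$; (3) $d_i({}^ab)=[d_0(a),{}^ab]+{}^a(d_i(b))$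 for $a\in L_0$, $b\in L_i$, $i\ge 1$. $\mathrm{Der}_m(L_\bullet)$ denotes the abelian group (under pointwise addition) of derivations of $L_\bullet$ of degree $m$. *)

theory Defs
  imports "HOL-Algebra.Group_Action"
begin

text \<open>
  All components of a graded object live in one type \<open>'a\<close>, the component of degree \<open>m\<close> being
  \<open>carrier (L m)\<close>. Carriers of different degrees may overlap, so brackets and actions carry
  the degrees of their arguments as indices. HOL-Algebra writes groups multiplicatively: in the
  abelian groups \<open>L m\<close>, \<open>m \<ge> 1\<close>, the symbols \<open>\<otimes>\<close>, \<open>\<one>\<close> and \<open>inv\<close> stand for addition, zero and
  negation. A graded Lie algebra starts in degree 1; its \<open>L 0\<close> is unconstrained.
\<close>

locale graded_lie_algebra =
  fixes L :: "nat \<Rightarrow> ('a, 'b) monoid_scheme"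
    and br :: "nat \<Rightarrow> nat \<Rightarrow> 'a \<Rightarrow> 'a \<Rightarrow> 'a"
  assumes comm_group: "m \<ge> 1 \<Longrightarrow> comm_group (L m)"
    and br_closed: "\<lbrakk>m \<ge> 1; n \<ge> 1; x \<in> carrier (L m); y \<in> carrier (L n)\<rbrakk>
      \<Longrightarrow> br m n x y \<in> carrier (L (m + n))"
    and br_add_left: "\<lbrakk>m \<ge> 1; n \<ge> 1; x \<in> carrier (L m); x' \<in> carrier (L m); y \<in> carrier (L n)\<rbrakk>
      \<Longrightarrow> br m n (x \<otimes>\<^bsub>L m\<^esub> x') y = br m n x y \<otimes>\<^bsub>L (m + n)\<^esub> br m n x' y"
    and br_add_right: "\<lbrakk>m \<ge> 1; n \<ge> 1; x \<in> carrier (L m); y \<in> carrier (L n); y' \<in> carrier (L n)\<rbrakk>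
      \<Longrightarrow> br m n x (y \<otimes>\<^bsub>L n\<^esub> y') = br m n x y \<otimes>\<^bsub>L (m + n)\<^esub> br m n x y'"
    and br_alternating: "\<lbrakk>m \<ge> 1; x \<in> carrier (L m)\<rbrakk> \<Longrightarrow> br m m x x = \<one>\<^bsub>L (m + m)\<^esub>"
    and br_antisym: "\<lbrakk>m \<ge> 1; n \<ge> 1; x \<in> carrier (L m); y \<in> carrier (L n)\<rbrakk>
      \<Longrightarrow> br m n x y = inv\<^bsub>L (m + n)\<^esub> (br n m y x)"
    and jacobi: "\<lbrakk>m \<ge> 1; n \<ge> 1; k \<ge> 1; x \<in> carrier (L m); y \<in> carrier (L n); z \<in> carrier (L k)\<rbrakk>
      \<Longrightarrow> br m (n + k) x (br n k y z) \<otimes>\<^bsub>L (m + n + k)\<^esub> br n (k + m) y (br k m z x)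
            \<otimes>\<^bsub>L (m + n + k)\<^esub> br k (m + n) z (br m n x y) = \<one>\<^bsub>L (m + n + k)\<^esub>"

text \<open>
  \<open>act i g x\<close> is \<open>\<^sup>gx\<close> for \<open>x\<close> of degree \<open>i\<close>. That each \<open>act i g\<close> is bijective is part of
  \<^const>\<open>group_action\<close>.
\<close>

locale eg_lie_algebra = graded_lie_algebra L br
  for L :: "nat \<Rightarrow> ('a, 'b) monoid_scheme" and br +
  fixes act :: "nat \<Rightarrow> 'a \<Rightarrow> 'a \<Rightarrow> 'a"
  assumes group_0: "group (L 0)"
    and act_action: "i \<ge> 1 \<Longrightarrow> group_action (L 0) (carrier (L i)) (act i)"
    and act_hom: "\<lbrakk>i \<ge> 1; g \<in> carrier (L 0)\<rbrakk> \<Longrightarrow> act i g \<in> hom (L i) (L i)"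
    and act_br: "\<lbrakk>i \<ge> 1; j \<ge> 1; g \<in> carrier (L 0); x \<in> carrier (L i); y \<in> carrier (L j)\<rbrakk>
      \<Longrightarrow> act (i + j) g (br i j x y) = br i j (act i g x) (act j g y)"

text \<open>
  The maps \<open>d i\<close> are extensional (\<^const>\<open>undefined\<close> off \<open>carrier (L i)\<close>), so that equality of
  derivations is equality of the families of maps \<open>L\<^sub>i \<rightarrow> L\<^sub>m\<^sub>+\<^sub>i\<close>.
\<close>

definition derivations ::
  "(nat \<Rightarrow> ('a, 'b) monoid_scheme) \<Rightarrow> (nat \<Rightarrow> nat \<Rightarrow> 'a \<Rightarrow> 'a \<Rightarrow> 'a) \<Rightarrow> (nat \<Rightarrow> 'a \<Rightarrow> 'a \<Rightarrow> 'a)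
    \<Rightarrow> nat \<Rightarrow> (nat \<Rightarrow> 'a \<Rightarrow> 'a) set" where
  "derivations L br act m = {d.
     (\<forall>i. d i \<in> carrier (L i) \<rightarrow>\<^sub>E carrier (L (m + i))) \<and>
     (\<forall>i\<ge>1. d i \<in> hom (L i) (L (m + i))) \<and>
     (\<forall>i\<ge>1. \<forall>j\<ge>1. \<forall>a\<in>carrier (L i). \<forall>b\<in>carrier (L j).
        d (i + j) (br i j a b) =
          br (m + i) j (d i a) b \<otimes>\<^bsub>L (m + i + j)\<^esub> br i (m + j) a (d j b)) \<and>
     (\<forall>a\<in>carrier (L 0). \<forall>b\<in>carrier (L 0).
        d 0 (a \<otimes>\<^bsub>L 0\<^esub> b) = d 0 a \<otimes>\<^bsub>L m\<^esub> act m a (d 0 b)) \<and>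
     (\<forall>i\<ge>1. \<forall>a\<in>carrier (L 0). \<forall>b\<in>carrier (L i).
        d i (act i a b) =
          br m i (d 0 a) (act i a b) \<otimes>\<^bsub>L (m + i)\<^esub> act (m + i) a (d i b))}"

definition Der ::
  "(nat \<Rightarrow> ('a, 'b) monoid_scheme) \<Rightarrow> (nat \<Rightarrow> nat \<Rightarrow> 'a \<Rightarrow> 'a \<Rightarrow> 'a) \<Rightarrow> (nat \<Rightarrow> 'a \<Rightarrow> 'a \<Rightarrow> 'a)
    \<Rightarrow> nat \<Rightarrow> (nat \<Rightarrow> 'a \<Rightarrow> 'a) monoid" where
  "Der L br act m =
    \<lparr>carrier = derivations L br act m,
     monoid.mult = (\<lambda>d d' i. \<lambda>a\<in>carrier (L i). d i a \<otimes>\<^bsub>L (m + i)\<^esub> d' i a),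
     one = (\<lambda>i. \<lambda>a\<in>carrier (L i). \<one>\<^bsub>L (m + i)\<^esub>)\<rparr>"

end

theory Submission
  imports Defs
begin

text \<open>
  A derivation of an eg-Lie algebra is an infinitesimal automorphism: it moves \<open>x\<close> of positive
  degree to \<open>x + d x\<close> and \<open>g\<close> in \<open>L\<^sub>0\<close> to \<open>exp(d\<^sub>0 g) g\<close>, up to terms of second order. The bracket is
  the second order part of the commutator of two such automorphisms. In positive degrees this
  is the commutator of maps, where bilinearity, antisymmetry and the Jacobi identity hold because
  composition of homomorphisms is biadditive and associative. In degree 0 the two factors
  \<open>exp(d\<^sub>0 a)\<close> and \<open>exp(d'\<^sub>0 a)\<close> appear in opposite orders in the two compositions, and this
  produces the correction term \<open>- [d\<^sub>0 a, d'\<^sub>0 a]\<close>.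

  Two points need an argument. The bracket must again be a derivation
  (\<open>der_bracket_closed\<close>): expanding \<open>d (d'\<^sub>0 (ab)) - d' (d\<^sub>0 (ab))\<close> with the cocycle rule and the rule for
  \<open>d (\<^sup>ax)\<close> leaves the cross terms \<open>[d\<^sub>0 a, \<^sup>a(d'\<^sub>0 b)]\<close> and \<open>- [d'\<^sub>0 a, \<^sup>a(d\<^sub>0 b)]\<close>, and these are
  exactly the cross terms of \<open>[d\<^sub>0 (ab), d'\<^sub>0 (ab)]\<close> by antisymmetry; compatibility with the
  action comes down to the Jacobi identity of \<open>L\<^sub>+\<close> for \<open>d\<^sub>0 a\<close>, \<open>d'\<^sub>0 a\<close> and \<open>\<^sup>ab\<close>. The Jacobi identity
  for derivations (\<open>der_bracket_jacobi\<close>) is, in degree 0, a sum of triple compositions, of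
  brackets of an iterated value with a single one, and of double brackets. The first two kinds
  cancel in pairs under the cyclic sum, the double brackets by the Jacobi identity of \<open>L\<^sub>+\<close>
  for \<open>d\<^sub>0 a\<close>, \<open>d'\<^sub>0 a\<close>, \<open>d''\<^sub>0 a\<close>.

  All of these are identities in abelian groups, and they are decided by one rewrite system:
  subtraction, written \<open>\<oslash>\<close> since the groups are multiplicative, is moved to the outside and
  then across the equation, until both sides are sums without negation that agree up to order.
\<close>

section \<open>Normalizing differences in abelian groups\<close>

text \<open>
  A constant of its own keeps the negated operand out of reach of the associative-commutative
  rewriting of \<open>\<otimes>\<close>, which would otherwise separate terms from their inverses.
\<close>

definition quot :: "('a, 'b) monoid_scheme \<Rightarrow> 'a \<Rightarrow> 'a \<Rightarrow> 'a" (infixl "\<oslash>\<index>" 70) where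
  "x \<oslash>\<^bsub>G\<^esub> y = x \<otimes>\<^bsub>G\<^esub> inv\<^bsub>G\<^esub> y"

context comm_group
begin

lemma quot_closed: "\<lbrakk>x \<in> carrier G; y \<in> carrier G\<rbrakk> \<Longrightarrow> x \<oslash> y \<in> carrier G"
  by (simp add: quot_def)

lemma inv_conv_quot: "x \<in> carrier G \<Longrightarrow> inv x = \<one> \<oslash> x"
  by (simp add: quot_def)

lemma quot_one: "x \<in> carrier G \<Longrightarrow> x \<oslash> \<one> = x"
  by (simp add: quot_def)

lemma quot_eq_iff:
  "\<lbrakk>x \<in> carrier G; y \<in> carrier G; z \<in> carrier G\<rbrakk> \<Longrightarrow> x \<oslash> y = z \<longleftrightarrow> x = z \<otimes> y"
  unfolding quot_def by (metis inv_closed inv_solve_right' m_closed)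

lemma eq_quot_iff:
  "\<lbrakk>x \<in> carrier G; y \<in> carrier G; z \<in> carrier G\<rbrakk> \<Longrightarrow> z = x \<oslash> y \<longleftrightarrow> z \<otimes> y = x"
  using quot_eq_iff by metis

lemma quot_rearrange:
  assumes "x \<in> carrier G" "y \<in> carrier G" "z \<in> carrier G"
  shows "x \<otimes> (y \<oslash> z) = (x \<otimes> y) \<oslash> z"
    and "(x \<oslash> y) \<otimes> z = (x \<otimes> z) \<oslash> y"
    and "(x \<oslash> y) \<oslash> z = x \<oslash> (y \<otimes> z)"
    and "x \<oslash> (y \<oslash> z) = (x \<otimes> z) \<oslash> y"
  using assms by (simp_all add: quot_def inv_mult m_ac)

lemmas abelian_simps =
  m_ac inv_conv_quot quot_eq_iff eq_quot_iff quot_rearrange quot_one l_one r_one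

end

lemma (in group_hom) hom_quot:
  "\<lbrakk>x \<in> carrier G; y \<in> carrier G\<rbrakk> \<Longrightarrow> h (x \<oslash>\<^bsub>G\<^esub> y) = h x \<oslash>\<^bsub>H\<^esub> h y"
  by (simp add: quot_def)

section \<open>Calculating in graded Lie algebras\<close>

context graded_lie_algebra
begin

lemmas component_simps = comm_group.abelian_simps[OF comm_group]

lemma component_closed:
  assumes "1 \<le> p"
  shows "\<one>\<^bsub>L p\<^esub> \<in> carrier (L p)"
    and "x \<in> carrier (L p) \<Longrightarrow> inv\<^bsub>L p\<^esub> x \<in> carrier (L p)"
    and "x \<in> carrier (L p) \<Longrightarrow> y \<in> carrier (L p) \<Longrightarrow> x \<otimes>\<^bsub>L p\<^esub> y \<in> carrier (L p)"
    and "x \<in> carrier (L p) \<Longrightarrow> y \<in> carrier (L p) \<Longrightarrow> x \<oslash>\<^bsub>L p\<^esub> y \<in> carrier (L p)"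
proof -
  interpret comm_group "L p" using assms by (rule comm_group)
  show "\<one>\<^bsub>L p\<^esub> \<in> carrier (L p)"
    and "x \<in> carrier (L p) \<Longrightarrow> inv\<^bsub>L p\<^esub> x \<in> carrier (L p)"
    and "x \<in> carrier (L p) \<Longrightarrow> y \<in> carrier (L p) \<Longrightarrow> x \<otimes>\<^bsub>L p\<^esub> y \<in> carrier (L p)"
    and "x \<in> carrier (L p) \<Longrightarrow> y \<in> carrier (L p) \<Longrightarrow> x \<oslash>\<^bsub>L p\<^esub> y \<in> carrier (L p)"
    by (simp_all add: quot_closed)
qed

text \<open>
  The separate variable \<open>p\<close> makes the rule apply to every rearrangement of \<open>m + n\<close>: degrees are
  sums that the simplifier sorts, after which they need not be of the form \<open>m + n\<close> for the
  degrees \<open>m\<close> and \<open>n\<close> of the arguments. The rules below with a premise \<open>p = m + n\<close> have this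
  form for the same reason.
\<close>

lemma br_in_component:
  "\<lbrakk>p = m + n; 1 \<le> m; 1 \<le> n; x \<in> carrier (L m); y \<in> carrier (L n)\<rbrakk>
    \<Longrightarrow> br m n x y \<in> carrier (L p)"
  using br_closed by blast

lemma br_group_hom_left:
  assumes "1 \<le> m" "1 \<le> n" "y \<in> carrier (L n)"
  shows "group_hom (L m) (L (m + n)) (\<lambda>x. br m n x y)"
  using assms comm_group[of m] comm_group[of "m + n"]
  by (auto simp: group_hom_def group_hom_axioms_def hom_def comm_group_def br_closed br_add_left)

lemma br_group_hom_right:
  assumes "1 \<le> m" "1 \<le> n" "x \<in> carrier (L m)"
  shows "group_hom (L n) (L (m + n)) (br m n x)"
  using assms comm_group[of n] comm_group[of "m + n"]
  by (auto simp: group_hom_def group_hom_axioms_def hom_def comm_group_def br_closed br_add_right)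

lemma br_quot_left:
  "\<lbrakk>1 \<le> m; 1 \<le> n; x \<in> carrier (L m); x' \<in> carrier (L m); y \<in> carrier (L n)\<rbrakk>
    \<Longrightarrow> br m n (x \<oslash>\<^bsub>L m\<^esub> x') y = br m n x y \<oslash>\<^bsub>L (m + n)\<^esub> br m n x' y"
  by (rule group_hom.hom_quot[OF br_group_hom_left])

lemma br_quot_right:
  "\<lbrakk>1 \<le> m; 1 \<le> n; x \<in> carrier (L m); y \<in> carrier (L n); y' \<in> carrier (L n)\<rbrakk>
    \<Longrightarrow> br m n x (y \<oslash>\<^bsub>L n\<^esub> y') = br m n x y \<oslash>\<^bsub>L (m + n)\<^esub> br m n x y'"
  by (rule group_hom.hom_quot[OF br_group_hom_right])

lemma br_one_left:
  "\<lbrakk>1 \<le> m; 1 \<le> n; y \<in> carrier (L n)\<rbrakk> \<Longrightarrow> br m n \<one>\<^bsub>L m\<^esub> y = \<one>\<^bsub>L (m + n)\<^esub>"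
  by (rule group_hom.hom_one[OF br_group_hom_left])

lemma br_one_right:
  "\<lbrakk>1 \<le> m; 1 \<le> n; x \<in> carrier (L m)\<rbrakk> \<Longrightarrow> br m n x \<one>\<^bsub>L n\<^esub> = \<one>\<^bsub>L (m + n)\<^esub>"
  by (rule group_hom.hom_one[OF br_group_hom_right])

lemmas bilinear = br_add_left br_add_right br_quot_left br_quot_right br_one_left br_one_right

lemma br_swap:
  "\<lbrakk>1 \<le> m; 1 \<le> n; x \<in> carrier (L m); y \<in> carrier (L n)\<rbrakk>
    \<Longrightarrow> br n m y x = \<one>\<^bsub>L (m + n)\<^esub> \<oslash>\<^bsub>L (m + n)\<^esub> br m n x y"
  using br_antisym[of n m y x] by (simp add: component_simps br_in_component add.commute)

text \<open>
  The Jacobi identity in the form "bracketing with \<open>x\<close> is a derivation". Unlike the cyclic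
  form it rewrites a single double bracket.
\<close>

lemma br_leibniz:
  assumes "1 \<le> m" "1 \<le> n" "1 \<le> k" "x \<in> carrier (L m)" "y \<in> carrier (L n)" "z \<in> carrier (L k)"
  shows "br m (n + k) x (br n k y z) =
    br (m + n) k (br m n x y) z \<otimes>\<^bsub>L (m + n + k)\<^esub> br n (m + k) y (br m k x z)"
proof -
  note closed = br_in_component component_closed
  have swap_inner: "br n (k + m) y (br k m z x) =
      \<one>\<^bsub>L (m + n + k)\<^esub> \<oslash>\<^bsub>L (m + n + k)\<^esub> br n (m + k) y (br m k x z)"
    using assms by (simp add: br_swap[of m k x z] closed bilinear add_ac)
  have swap_outer: "br k (m + n) z (br m n x y) =
      \<one>\<^bsub>L (m + n + k)\<^esub> \<oslash>\<^bsub>L (m + n + k)\<^esub> br (m + n) k (br m n x y) z"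
    using assms by (simp add: br_swap[of "m + n" k _ z] closed)
  show ?thesis
    using jacobi[OF assms] assms unfolding swap_inner swap_outer
    by (simp add: component_simps closed)
qed

end

section \<open>Derivations of eg-Lie algebras\<close>

context eg_lie_algebra
begin

lemma act_closed: "\<lbrakk>1 \<le> i; g \<in> carrier (L 0); x \<in> carrier (L i)\<rbrakk> \<Longrightarrow> act i g x \<in> carrier (L i)"
  using act_hom[of i g] by (auto simp: hom_def)

lemma act_group_hom: "\<lbrakk>1 \<le> i; g \<in> carrier (L 0)\<rbrakk> \<Longrightarrow> group_hom (L i) (L i) (act i g)"
  using act_hom comm_group[of i] by (auto simp: group_hom_def group_hom_axioms_def comm_group_def)

lemmas act_linear = group_hom.hom_mult[OF act_group_hom] group_hom.hom_quot[OF act_group_hom]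
  group_hom.hom_one[OF act_group_hom]

lemma act_br_degree:
  "\<lbrakk>p = i + j; 1 \<le> i; 1 \<le> j; g \<in> carrier (L 0); x \<in> carrier (L i); y \<in> carrier (L j)\<rbrakk>
    \<Longrightarrow> act p g (br i j x y) = br i j (act i g x) (act j g y)"
  using act_br by blast

lemmas closed = br_in_component component_closed act_closed
  group.is_monoid[OF group_0, THEN monoid.m_closed]

lemmas eg_lie_simps = closed bilinear act_linear act_br_degree component_simps add_ac

lemma derivationsI:
  assumes "\<And>i. d i \<in> extensional (carrier (L i))"
    and "\<And>i a. a \<in> carrier (L i) \<Longrightarrow> d i a \<in> carrier (L (m + i))"
    and "\<And>i a b. \<lbrakk>1 \<le> i; a \<in> carrier (L i); b \<in> carrier (L i)\<rbrakk>
      \<Longrightarrow> d i (a \<otimes>\<^bsub>L i\<^esub> b) = d i a \<otimes>\<^bsub>L (m + i)\<^esub> d i b"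
    and "\<And>i j a b. \<lbrakk>1 \<le> i; 1 \<le> j; a \<in> carrier (L i); b \<in> carrier (L j)\<rbrakk>
      \<Longrightarrow> d (i + j) (br i j a b) =
        br (m + i) j (d i a) b \<otimes>\<^bsub>L (m + i + j)\<^esub> br i (m + j) a (d j b)"
    and "\<And>a b. \<lbrakk>a \<in> carrier (L 0); b \<in> carrier (L 0)\<rbrakk>
      \<Longrightarrow> d 0 (a \<otimes>\<^bsub>L 0\<^esub> b) = d 0 a \<otimes>\<^bsub>L m\<^esub> act m a (d 0 b)"
    and "\<And>i a b. \<lbrakk>1 \<le> i; a \<in> carrier (L 0); b \<in> carrier (L i)\<rbrakk>
      \<Longrightarrow> d i (act i a b) = br m i (d 0 a) (act i a b) \<otimes>\<^bsub>L (m + i)\<^esub> act (m + i) a (d i b)"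
  shows "d \<in> derivations L br act m"
  unfolding derivations_def hom_def PiE_def using assms by auto

end

text \<open>
  Fixing a derivation in a locale turns its defining properties into rewrite rules with a fixed
  head symbol. Statements about several derivations interpret the locale once for each.
\<close>

locale eg_derivation = eg_lie_algebra L br act
  for L :: "nat \<Rightarrow> ('a, 'b) monoid_scheme" and br and act +
  fixes m :: nat and d :: "nat \<Rightarrow> 'a \<Rightarrow> 'a"
  assumes degree: "1 \<le> m" and deriv: "d \<in> derivations L br act m"
begin

lemma d_closed: "\<lbrakk>p = m + i; a \<in> carrier (L i)\<rbrakk> \<Longrightarrow> d i a \<in> carrier (L p)"
  using deriv unfolding derivations_def by blast

lemma d_group_hom: "1 \<le> i \<Longrightarrow> group_hom (L i) (L (m + i)) (d i)"
  using deriv comm_group[of i] comm_group[of "m + i"] degree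
  by (auto simp: group_hom_def group_hom_axioms_def derivations_def comm_group_def)

lemmas d_linear = group_hom.hom_mult[OF d_group_hom] group_hom.hom_quot[OF d_group_hom]
  group_hom.hom_one[OF d_group_hom]

lemma d_br:
  "\<lbrakk>p = i + j; 1 \<le> i; 1 \<le> j; a \<in> carrier (L i); b \<in> carrier (L j)\<rbrakk>
    \<Longrightarrow> d p (br i j a b) = br (m + i) j (d i a) b \<otimes>\<^bsub>L (m + i + j)\<^esub> br i (m + j) a (d j b)"
  using deriv unfolding derivations_def by blast

lemma d_cocycle:
  "\<lbrakk>a \<in> carrier (L 0); b \<in> carrier (L 0)\<rbrakk>
    \<Longrightarrow> d 0 (a \<otimes>\<^bsub>L 0\<^esub> b) = d 0 a \<otimes>\<^bsub>L m\<^esub> act m a (d 0 b)"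
  using deriv unfolding derivations_def by blast

lemma d_act:
  "\<lbrakk>1 \<le> i; a \<in> carrier (L 0); b \<in> carrier (L i)\<rbrakk>
    \<Longrightarrow> d i (act i a b) = br m i (d 0 a) (act i a b) \<otimes>\<^bsub>L (m + i)\<^esub> act (m + i) a (d i b)"
  using deriv unfolding derivations_def by blast

lemmas d_rules = d_closed d_linear d_br d_cocycle d_act

end

section \<open>The abelian group of derivations of a given degree\<close>

lemma Der_sel:
  "carrier (Der L br act m) = derivations L br act m"
  "a \<in> carrier (L i) \<Longrightarrow> (d \<otimes>\<^bsub>Der L br act m\<^esub> d') i a = d i a \<otimes>\<^bsub>L (m + i)\<^esub> d' i a"
  "a \<in> carrier (L i) \<Longrightarrow> \<one>\<^bsub>Der L br act m\<^esub> i a = \<one>\<^bsub>L (m + i)\<^esub>"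
  "(d \<otimes>\<^bsub>Der L br act m\<^esub> d') i \<in> extensional (carrier (L i))"
  "\<one>\<^bsub>Der L br act m\<^esub> i \<in> extensional (carrier (L i))"
  by (simp_all add: Der_def)

lemma derivations_eqI:
  assumes "d \<in> derivations L br act m" "d' \<in> derivations L br act m"
    and "\<And>i a. a \<in> carrier (L i) \<Longrightarrow> d i a = d' i a"
  shows "d = d'"
proof
  fix i
  have "d i \<in> extensional (carrier (L i))" "d' i \<in> extensional (carrier (L i))"
    using assms(1,2) unfolding derivations_def PiE_def by auto
  then show "d i = d' i" using assms(3) by (rule extensionalityI)
qed

context eg_lie_algebra
begin

abbreviation "Der\<^sub>L \<equiv> Der L br act"
abbreviation "derivations\<^sub>L \<equiv> derivations L br act"

lemma derivations_mult_closed: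
  assumes "1 \<le> m" "d \<in> derivations\<^sub>L m" "d' \<in> derivations\<^sub>L m"
  shows "d \<otimes>\<^bsub>Der\<^sub>L m\<^esub> d' \<in> derivations\<^sub>L m"
proof -
  interpret D: eg_derivation L br act m d using assms by unfold_locales
  interpret D': eg_derivation L br act m d' using assms by unfold_locales
  show ?thesis
    by (rule derivationsI)
      (use assms(1) in \<open>simp_all add: eg_lie_simps Der_sel D.d_rules D'.d_rules\<close>)
qed

lemma derivations_one_closed: "1 \<le> m \<Longrightarrow> \<one>\<^bsub>Der\<^sub>L m\<^esub> \<in> derivations\<^sub>L m"
  by (rule derivationsI) (simp_all add: eg_lie_simps Der_sel)

lemma Der_comm_group:
  assumes "1 \<le> m"
  shows "comm_group (Der\<^sub>L m)"
proof (rule comm_groupI; (unfold Der_sel)?)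
  note simps = eg_lie_simps Der_sel derivations_mult_closed derivations_one_closed
  show "d \<otimes>\<^bsub>Der\<^sub>L m\<^esub> d' \<in> derivations\<^sub>L m" if "d \<in> derivations\<^sub>L m" "d' \<in> derivations\<^sub>L m" for d d'
    using assms that by (rule derivations_mult_closed)
  show "\<one>\<^bsub>Der\<^sub>L m\<^esub> \<in> derivations\<^sub>L m"
    using assms by (rule derivations_one_closed)
  show "d \<otimes>\<^bsub>Der\<^sub>L m\<^esub> d' \<otimes>\<^bsub>Der\<^sub>L m\<^esub> d'' = d \<otimes>\<^bsub>Der\<^sub>L m\<^esub> (d' \<otimes>\<^bsub>Der\<^sub>L m\<^esub> d'')"
    if "d \<in> derivations\<^sub>L m" "d' \<in> derivations\<^sub>L m" "d'' \<in> derivations\<^sub>L m" for d d' d''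
  proof -
    interpret D: eg_derivation L br act m d using assms that by unfold_locales
    interpret D': eg_derivation L br act m d' using assms that by unfold_locales
    interpret D'': eg_derivation L br act m d'' using assms that by unfold_locales
    show ?thesis
      by (rule derivations_eqI[of _ L br act m])
        (use assms that in \<open>simp_all add: simps D.d_closed D'.d_closed D''.d_closed\<close>)
  qed
  show "d \<otimes>\<^bsub>Der\<^sub>L m\<^esub> d' = d' \<otimes>\<^bsub>Der\<^sub>L m\<^esub> d"
    if "d \<in> derivations\<^sub>L m" "d' \<in> derivations\<^sub>L m" for d d'
  proof -
    interpret D: eg_derivation L br act m d using assms that by unfold_locales
    interpret D': eg_derivation L br act m d' using assms that by unfold_locales
    show ?thesis
      by (rule derivations_eqI[of _ L br act m])
        (use assms that in \<open>simp_all add: simps D.d_closed D'.d_closed\<close>)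
  qed
  show "\<one>\<^bsub>Der\<^sub>L m\<^esub> \<otimes>\<^bsub>Der\<^sub>L m\<^esub> d = d" if "d \<in> derivations\<^sub>L m" for d
  proof -
    interpret D: eg_derivation L br act m d using assms that by unfold_locales
    show ?thesis
      by (rule derivations_eqI[of _ L br act m])
        (use assms that in \<open>simp_all add: simps D.d_closed\<close>)
  qed
  show "\<exists>d'\<in>derivations\<^sub>L m. d' \<otimes>\<^bsub>Der\<^sub>L m\<^esub> d = \<one>\<^bsub>Der\<^sub>L m\<^esub>" if "d \<in> derivations\<^sub>L m" for d
  proof -
    interpret D: eg_derivation L br act m d using assms that by unfold_locales
    define d' where "d' = (\<lambda>i. \<lambda>a\<in>carrier (L i). \<one>\<^bsub>L (m + i)\<^esub> \<oslash>\<^bsub>L (m + i)\<^esub> d i a)"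
    have d': "d' i a = \<one>\<^bsub>L (m + i)\<^esub> \<oslash>\<^bsub>L (m + i)\<^esub> d i a" if "a \<in> carrier (L i)" for i a
      using that by (simp add: d'_def)
    have "d' \<in> derivations\<^sub>L m"
      by (rule derivationsI)
        (simp add: d'_def, use assms in \<open>simp_all add: d' eg_lie_simps D.d_rules\<close>)
    moreover from this have "d' \<otimes>\<^bsub>Der\<^sub>L m\<^esub> d = \<one>\<^bsub>Der\<^sub>L m\<^esub>"
      by (intro derivations_eqI[of _ L br act m])
        (use assms that in \<open>simp_all add: simps d' D.d_closed\<close>)
    ultimately show ?thesis by blast
  qed
qed

end

section \<open>The bracket of derivations\<close>

context eg_lie_algebra
begin

definition der_bracket ::
  "nat \<Rightarrow> nat \<Rightarrow> (nat \<Rightarrow> 'a \<Rightarrow> 'a) \<Rightarrow> (nat \<Rightarrow> 'a \<Rightarrow> 'a) \<Rightarrow> nat \<Rightarrow> 'a \<Rightarrow> 'a" where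
  "der_bracket m n d d' = (\<lambda>i. \<lambda>a\<in>carrier (L i).
     if i = 0
     then d n (d' 0 a) \<oslash>\<^bsub>L (m + n)\<^esub> d' m (d 0 a) \<oslash>\<^bsub>L (m + n)\<^esub> br m n (d 0 a) (d' 0 a)
     else d (n + i) (d' i a) \<oslash>\<^bsub>L (m + n + i)\<^esub> d' (m + i) (d i a))"

lemma der_bracket_0:
  "a \<in> carrier (L 0) \<Longrightarrow> der_bracket m n d d' 0 a =
    d n (d' 0 a) \<oslash>\<^bsub>L (m + n)\<^esub> d' m (d 0 a) \<oslash>\<^bsub>L (m + n)\<^esub> br m n (d 0 a) (d' 0 a)"
  by (simp add: der_bracket_def)

lemma der_bracket_pos:
  "\<lbrakk>1 \<le> i; a \<in> carrier (L i)\<rbrakk> \<Longrightarrow> der_bracket m n d d' i a =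
    d (n + i) (d' i a) \<oslash>\<^bsub>L (m + n + i)\<^esub> d' (m + i) (d i a)"
  by (simp add: der_bracket_def)

lemmas der_bracket_simps = der_bracket_0 der_bracket_pos eg_lie_simps Der_sel

text \<open>
  The correction term in degree 0 is what makes this true. The commutator of maps alone fails
  the cocycle rule by the cross terms of \<open>[d\<^sub>0 (ab), d'\<^sub>0 (ab)]\<close>, and its value at \<open>\<^sup>ab\<close> contains
  \<open>[d'\<^sub>0 a, [d\<^sub>0 a, \<^sup>ab]] - [d\<^sub>0 a, [d'\<^sub>0 a, \<^sup>ab]]\<close>, which is \<open>- [[d\<^sub>0 a, d'\<^sub>0 a], \<^sup>ab]\<close>.
\<close>

lemma der_bracket_closed:
  assumes "p = m + n" "1 \<le> m" "1 \<le> n" "d \<in> derivations\<^sub>L m" "d' \<in> derivations\<^sub>L n"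
  shows "der_bracket m n d d' \<in> derivations\<^sub>L p"
proof -
  interpret D: eg_derivation L br act m d using assms by unfold_locales
  interpret D': eg_derivation L br act n d' using assms by unfold_locales
  note simps = der_bracket_simps D.d_rules D'.d_rules
  let ?B = "der_bracket m n d d'"
  show ?thesis
    unfolding assms(1)
  proof (rule derivationsI)
    show "?B i \<in> extensional (carrier (L i))" for i
      by (simp add: der_bracket_def)
    show "?B i a \<in> carrier (L (m + n + i))" if "a \<in> carrier (L i)" for i a
      using that assms(2,3) by (cases "i = 0") (simp_all add: simps)
    show "?B i (a \<otimes>\<^bsub>L i\<^esub> b) = ?B i a \<otimes>\<^bsub>L (m + n + i)\<^esub> ?B i b"
      if "1 \<le> i" "a \<in> carrier (L i)" "b \<in> carrier (L i)" for i a b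
      using that assms(2,3) by (simp add: simps)
    show "?B (i + j) (br i j a b) =
        br (m + n + i) j (?B i a) b \<otimes>\<^bsub>L (m + n + i + j)\<^esub> br i (m + n + j) a (?B j b)"
      if "1 \<le> i" "1 \<le> j" "a \<in> carrier (L i)" "b \<in> carrier (L j)" for i j a b
      using that assms(2,3) by (simp add: simps)
    \<comment> \<open>The cross terms \<open>[d'\<^sub>0 a, \<^sup>a(d\<^sub>0 b)]\<close> and \<open>[\<^sup>a(d\<^sub>0 b), d'\<^sub>0 a]\<close> occur; they cancel once swapped.\<close>
    show "?B 0 (a \<otimes>\<^bsub>L 0\<^esub> b) = ?B 0 a \<otimes>\<^bsub>L (m + n)\<^esub> act (m + n) a (?B 0 b)"
      if "a \<in> carrier (L 0)" "b \<in> carrier (L 0)" for a b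
      using that assms(2,3) by (simp add: simps br_swap[of m n "act m a (d 0 b)" "d' 0 a"])
    show "?B i (act i a b) =
        br (m + n) i (?B 0 a) (act i a b) \<otimes>\<^bsub>L (m + n + i)\<^esub> act (m + n + i) a (?B i b)"
      if "1 \<le> i" "a \<in> carrier (L 0)" "b \<in> carrier (L i)" for i a b
      using that assms(2,3) br_leibniz[of m n i "d 0 a" "d' 0 a" "act i a b"]
      by (simp add: simps)
  qed
qed

lemma der_bracket_add_left:
  assumes "1 \<le> m" "1 \<le> n" "d \<in> derivations\<^sub>L m" "e \<in> derivations\<^sub>L m" "d' \<in> derivations\<^sub>L n"
  shows "der_bracket m n (d \<otimes>\<^bsub>Der\<^sub>L m\<^esub> e) d' =
    der_bracket m n d d' \<otimes>\<^bsub>Der\<^sub>L (m + n)\<^esub> der_bracket m n e d'"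
proof -
  interpret D: eg_derivation L br act m d using assms by unfold_locales
  interpret E: eg_derivation L br act m e using assms by unfold_locales
  interpret D': eg_derivation L br act n d' using assms by unfold_locales
  note simps = der_bracket_simps D.d_rules D'.d_rules E.d_rules
  show ?thesis
  proof (rule derivations_eqI[of _ L br act "m + n"])
    show "der_bracket m n (d \<otimes>\<^bsub>Der\<^sub>L m\<^esub> e) d' i a =
        (der_bracket m n d d' \<otimes>\<^bsub>Der\<^sub>L (m + n)\<^esub> der_bracket m n e d') i a"
      if "a \<in> carrier (L i)" for i a
      using that assms(1,2) by (cases "i = 0") (simp_all add: simps)
  qed (use assms in \<open>simp_all add: der_bracket_closed derivations_mult_closed\<close>)
qed

lemma der_bracket_add_right:
  assumes "1 \<le> m" "1 \<le> n" "d \<in> derivations\<^sub>L m" "d' \<in> derivations\<^sub>L n" "e \<in> derivations\<^sub>L n"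
  shows "der_bracket m n d (d' \<otimes>\<^bsub>Der\<^sub>L n\<^esub> e) =
    der_bracket m n d d' \<otimes>\<^bsub>Der\<^sub>L (m + n)\<^esub> der_bracket m n d e"
proof -
  interpret D: eg_derivation L br act m d using assms by unfold_locales
  interpret D': eg_derivation L br act n d' using assms by unfold_locales
  interpret E: eg_derivation L br act n e using assms by unfold_locales
  note simps = der_bracket_simps D.d_rules D'.d_rules E.d_rules
  show ?thesis
  proof (rule derivations_eqI[of _ L br act "m + n"])
    show "der_bracket m n d (d' \<otimes>\<^bsub>Der\<^sub>L n\<^esub> e) i a =
        (der_bracket m n d d' \<otimes>\<^bsub>Der\<^sub>L (m + n)\<^esub> der_bracket m n d e) i a"
      if "a \<in> carrier (L i)" for i a
      using that assms(1,2) by (cases "i = 0") (simp_all add: simps)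
  qed (use assms in \<open>simp_all add: der_bracket_closed derivations_mult_closed\<close>)
qed

lemma der_bracket_alternating:
  assumes "1 \<le> m" "d \<in> derivations\<^sub>L m"
  shows "der_bracket m m d d = \<one>\<^bsub>Der\<^sub>L (m + m)\<^esub>"
proof -
  interpret D: eg_derivation L br act m d using assms by unfold_locales
  show ?thesis
  proof (rule derivations_eqI[of _ L br act "m + m"])
    show "der_bracket m m d d i a = \<one>\<^bsub>Der\<^sub>L (m + m)\<^esub> i a" if "a \<in> carrier (L i)" for i a
      using that assms(1)
      by (cases "i = 0") (simp_all add: der_bracket_simps br_alternating D.d_rules)
  qed (use assms in \<open>simp_all add: der_bracket_closed derivations_one_closed\<close>)
qed

lemma der_bracket_antisym:
  assumes "1 \<le> m" "1 \<le> n" "d \<in> derivations\<^sub>L m" "d' \<in> derivations\<^sub>L n"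
  shows "der_bracket m n d d' = inv\<^bsub>Der\<^sub>L (m + n)\<^esub> (der_bracket n m d' d)"
proof -
  interpret D: eg_derivation L br act m d using assms by unfold_locales
  interpret D': eg_derivation L br act n d' using assms by unfold_locales
  interpret G: comm_group "Der\<^sub>L (m + n)" using assms by (simp add: Der_comm_group)
  have closed': "der_bracket m n d d' \<in> derivations\<^sub>L (m + n)"
      "der_bracket n m d' d \<in> derivations\<^sub>L (m + n)"
    using assms by (simp_all add: der_bracket_closed)
  have "der_bracket m n d d' \<otimes>\<^bsub>Der\<^sub>L (m + n)\<^esub> der_bracket n m d' d = \<one>\<^bsub>Der\<^sub>L (m + n)\<^esub>"
  proof (rule derivations_eqI[of _ L br act "m + n"])
    show "(der_bracket m n d d' \<otimes>\<^bsub>Der\<^sub>L (m + n)\<^esub> der_bracket n m d' d) i a =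
        \<one>\<^bsub>Der\<^sub>L (m + n)\<^esub> i a" if "a \<in> carrier (L i)" for i a
      using that assms(1,2)
      by (cases "i = 0")
        (simp_all add: der_bracket_simps D.d_rules D'.d_rules br_swap[of m n "d 0 a" "d' 0 a"])
  qed (use assms closed' in \<open>simp_all add: derivations_mult_closed derivations_one_closed\<close>)
  then show ?thesis using G.inv_equality closed' by (metis Der_sel(1))
qed

lemma der_bracket_jacobi:
  assumes "1 \<le> m" "1 \<le> n" "1 \<le> k"
    and "d \<in> derivations\<^sub>L m" "d' \<in> derivations\<^sub>L n" "d'' \<in> derivations\<^sub>L k"
  shows "der_bracket m (n + k) d (der_bracket n k d' d'')
      \<otimes>\<^bsub>Der\<^sub>L (m + n + k)\<^esub> der_bracket n (k + m) d' (der_bracket k m d'' d)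
      \<otimes>\<^bsub>Der\<^sub>L (m + n + k)\<^esub> der_bracket k (m + n) d'' (der_bracket m n d d')
    = \<one>\<^bsub>Der\<^sub>L (m + n + k)\<^esub>" (is "?J = _")
proof -
  interpret D: eg_derivation L br act m d using assms by unfold_locales
  interpret D': eg_derivation L br act n d' using assms by unfold_locales
  interpret D'': eg_derivation L br act k d'' using assms by unfold_locales
  note simps = der_bracket_simps D.d_rules D'.d_rules D''.d_rules
  show ?thesis
  proof (rule derivations_eqI[of _ L br act "m + n + k"])
    fix i a assume a: "a \<in> carrier (L i)"
    show "?J i a = \<one>\<^bsub>Der\<^sub>L (m + n + k)\<^esub> i a"
    proof (cases "i = 0")
      case False
      with a assms(1-3) show ?thesis by (simp add: simps)
    next
      case True
      then have vals: "d 0 a \<in> carrier (L m)" "d' 0 a \<in> carrier (L n)" "d'' 0 a \<in> carrier (L k)"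
        using a by (simp_all add: simps)
      let ?p = "k + (m + n)"
      \<comment> \<open>Degrees are written as the simplifier sorts them, so that these equations rewrite.
        They orient the three brackets whose first entry is an iterated value, of which each
        cancels against a bracket produced by another cyclic summand.\<close>
      have swap:
        "br (m + n) k (d n (d' 0 a)) (d'' 0 a) =
          \<one>\<^bsub>L ?p\<^esub> \<oslash>\<^bsub>L ?p\<^esub> br k (m + n) (d'' 0 a) (d n (d' 0 a))"
        "br (k + n) m (d' k (d'' 0 a)) (d 0 a) =
          \<one>\<^bsub>L ?p\<^esub> \<oslash>\<^bsub>L ?p\<^esub> br m (k + n) (d 0 a) (d' k (d'' 0 a))"
        "br (k + m) n (d'' m (d 0 a)) (d' 0 a) =
          \<one>\<^bsub>L ?p\<^esub> \<oslash>\<^bsub>L ?p\<^esub> br n (k + m) (d' 0 a) (d'' m (d 0 a))"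
        using vals assms(1-3) br_swap[of k "m + n" "d'' 0 a" "d n (d' 0 a)"]
          br_swap[of m "k + n" "d 0 a" "d' k (d'' 0 a)"]
          br_swap[of n "k + m" "d' 0 a" "d'' m (d 0 a)"]
        by (simp_all add: closed add_ac D.d_closed D'.d_closed D''.d_closed)
      have double: "br m (k + n) (d 0 a) (br n k (d' 0 a) (d'' 0 a)) =
          \<one>\<^bsub>L ?p\<^esub> \<oslash>\<^bsub>L ?p\<^esub> (br n (k + m) (d' 0 a) (br k m (d'' 0 a) (d 0 a))
            \<otimes>\<^bsub>L ?p\<^esub> br k (m + n) (d'' 0 a) (br m n (d 0 a) (d' 0 a)))"
        using jacobi[OF assms(1-3) vals] vals assms(1-3)
        by (simp add: closed component_simps add_ac)
      show ?thesis
        using a True assms(1-3) by (simp add: simps swap double)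
    qed
  qed (use assms in \<open>simp_all add: der_bracket_closed derivations_mult_closed
      derivations_one_closed add_ac\<close>)
qed

theorem Der_graded_lie_algebra: "graded_lie_algebra Der\<^sub>L der_bracket"
  by (rule graded_lie_algebra.intro; (unfold Der_sel(1))?)
    (rule Der_comm_group der_bracket_closed[OF refl] der_bracket_add_left der_bracket_add_right
      der_bracket_alternating der_bracket_antisym der_bracket_jacobi; assumption)+

end

section \<open>The graded Lie algebra of derivations\<close>

theorem theorem5p2:
  fixes L :: "nat \<Rightarrow> ('a, 'b) monoid_scheme"
    and br :: "nat \<Rightarrow> nat \<Rightarrow> 'a \<Rightarrow> 'a \<Rightarrow> 'a"
    and act :: "nat \<Rightarrow> 'a \<Rightarrow> 'a \<Rightarrow> 'a"
  assumes "eg_lie_algebra L br act"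
  shows "\<exists>B. graded_lie_algebra (Der L br act) B \<and>
    (\<forall>m\<ge>1. \<forall>n\<ge>1. \<forall>d\<in>carrier (Der L br act m). \<forall>d'\<in>carrier (Der L br act n).
      (\<forall>a\<in>carrier (L 0).
         B m n d d' 0 a =
           d n (d' 0 a) \<otimes>\<^bsub>L (m + n)\<^esub> inv\<^bsub>L (m + n)\<^esub> (d' m (d 0 a))
             \<otimes>\<^bsub>L (m + n)\<^esub> inv\<^bsub>L (m + n)\<^esub> (br m n (d 0 a) (d' 0 a))) \<and>
      (\<forall>i\<ge>1. \<forall>a\<in>carrier (L i).
         B m n d d' i a =
           d (n + i) (d' i a) \<otimes>\<^bsub>L (m + n + i)\<^esub>
             inv\<^bsub>L (m + n + i)\<^esub> (d' (m + i) (d i a))))"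
proof -
  interpret eg_lie_algebra L br act by fact
  show ?thesis
    using Der_graded_lie_algebra
    by (intro exI[of _ der_bracket]) (simp add: der_bracket_0 der_bracket_pos quot_def)
qed

end
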